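(* Let $$\Sigma_p=\begin{bmatrix}A_p&\begin{bmatrix}B_{p_1}&B_{p_2}\end{bmatrix}\\ \begin{bmatrix}C_{p_1}\\ C_{p_2}\end{bmatrix}&\begin{bmatrix}D_{p_{11}}&D_{p_{12}}\\ D_{p_{21}}&D_{p_{22}}\end{bmatrix}\end{bmatrix}\quad\text{and}\quad\Sigma_q=\begin{bmatrix}A_q&\begin{bmatrix}B_{q_1}&B_{q_2}\end{bmatrix}\\ \begin{bmatrix}C_{q_1}\\ C_{q_2}\end{bmatrix}&\begin{bmatrix}D_{q_{11}}&D_{q_{12}}\\ D_{q_{21}}&D_{q_{22}}\end{bmatrix}\end{bmatrix}$$ be linear systems with split inputs $(u_1,u_2)$, $(\tilde u_1,\tilde u_2)$ and split outputs $(y_1,y_2)$, $(\tilde y_1,\tilde y_2)$, respectively, whose signals are dimensionally compatible for the coupling $u_2=\tilde y_1$, $\tilde u_1=y_2$. Assume further that the matrices $D_{p_{21}}$, $D_{q_{21}}$ and $\Delta_1:=I-D_{p_{22}}D_{q_{11}}$ are invertible. Then: (1) The chain transforms $\mathrm{CHAIN}(\Sigma_p)$ and $\mathrm{CHAIN}(\Sigma_q)$ exist. (2) There exists a state space realisation, denoted by $\Sigma_p\star\Sigma_q$, such that $\mathrm{CHAIN}(\Sigma_p\star\Sigma_q)$ exists and satisfies $$\mathrm{CHAIN}(\Sigma_p\star\Sigma_q)=\mathrm{CHAIN}(\Sigma_p)*\mathrm{CHAIN}(\Sigma_q),$$ where $*$ denotes the cascade product of realisations. (3) The input and output signals of $\Sigma_p\star\Sigma_q$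 have the same relations as the external signals $\begin{bmatrix}u_1\\ \tilde u_2\end{bmatrix}$ and $\begin{bmatrix}y_1\\ \tilde y_2\end{bmatrix}$ of the feedback connection: $\begin{bmatrix}y_1\\ \tilde y_2\end{bmatrix}$ is an output of $\Sigma_p\star\Sigma_q$ for the input $\begin{bmatrix}u_1\\ \tilde u_2\end{bmatrix}$ (with some state trajectory) if and only if there are internal signals $u_2,y_2,\tilde u_1,\tilde y_1$ with $u_2=\tilde y_1$, $\tilde u_1=y_2$ such that $(y_1,y_2)$ is an output of $\Sigma_p$ for the input $(u_1,u_2)$ and $(\tilde y_1,\tilde y_2)$ is an output of $\Sigma_q$ for the input $(\tilde u_1,\tilde u_2)$ (with some state trajectories).
   Context: All matrices and signals are real and finite-dimensional. A linear system (state space realisation) $\Sigma=\begin{bmatrix}A&B\\ C&D\end{bmatrix}$ is the quadruple of matrices in $x'(t)=Ax(t)+Bu(t)$, $y(t)=Cx(t)+Du(t)$, with signals on a time interval, sufficiently smooth for classical solvability. Input and output have the same even dimension $m$ and are split as $u=\begin{bmatrix}u_1\\ u_2\end{bmatrix}$, $y=\begin{bmatrix}y_1\\ y_2\end{bmatrix}$ with all four components of dimension $m/2$; $B,C,D$ are split accordingly. The chain transform of $\Sigma=\begin{bmatrix}A&\begin{bmatrix}B_1&B_2\end{bmatrix}\\ \begin{bmatrix}C_1\\ C_2\end{bmatrix}&\begin{bmatrix}D_{11}&D_{12}\\ D_{21}&D_{22}\end{bmatrix}\end{bmatrix}$ exists if and only if $D_{21}$ is invertible, and is $$\mathrm{CHAIN}(\Sigma)=\begin{bmatrix}A-B_1D_{21}^{-1}C_2&\begin{bmatrix}B_2-B_1D_{21}^{-1}D_{22}&B_1D_{21}^{-1}\end{bmatrix}\\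 \begin{bmatrix}C_1-D_{11}D_{21}^{-1}C_2\\ -D_{21}^{-1}C_2\end{bmatrix}&\begin{bmatrix}D_{12}-D_{11}D_{21}^{-1}D_{22}&D_{11}D_{21}^{-1}\\ -D_{21}^{-1}D_{22}&D_{21}^{-1}\end{bmatrix}\end{bmatrix};$$ it has input $(u_2,y_2)$ and output $(y_1,u_1)$ in terms of the signals of $\Sigma$. The cascade product of $\Sigma_a=\begin{bmatrix}A_a&B_a\\ C_a&D_a\end{bmatrix}$ and $\Sigma_b=\begin{bmatrix}A_b&B_b\\ C_b&D_b\end{bmatrix}$ is $$\Sigma_a*\Sigma_b=\begin{bmatrix}\begin{matrix}A_a&B_aC_b\\ 0&A_b\end{matrix}&\begin{matrix}B_aD_b\\ B_b\end{matrix}\\ \begin{matrix}C_a&D_aC_b\end{matrix}&D_aD_b\end{bmatrix}.$$ *)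

theory Defs
  imports
    "HOL-Analysis.Analysis"
    "Jordan_Normal_Form.Gauss_Jordan_Elimination"
begin

hide_type (open) Finite_Cartesian_Product.vec

text \<open>
  Matrices and vectors are those of Jordan_Normal_Form, so that dimensions are ordinary natural
  numbers; state dimension 0 (a static system) is included.
\<close>

record lin_sys =
  sysA :: "real mat"
  sysB :: "real mat"
  sysC :: "real mat"
  sysD :: "real mat"

definition realisation :: "nat \<Rightarrow> nat \<Rightarrow> lin_sys \<Rightarrow> bool" where
  "realisation n m S \<longleftrightarrow>
     sysA S \<in> carrier_mat n n \<and> sysB S \<in> carrier_mat n m \<and>
     sysC S \<in> carrier_mat m n \<and> sysD S \<in> carrier_mat m m"

definition append_cols :: "real mat \<Rightarrow> real mat \<Rightarrow> real mat" (infixr \<open>@\<^sub>c\<close> 65) where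
  "M @\<^sub>c N = four_block_mat M N (0\<^sub>m 0 (dim_col M)) (0\<^sub>m 0 (dim_col N))"

definition split_sys ::
  "real mat \<Rightarrow> real mat \<Rightarrow> real mat \<Rightarrow> real mat \<Rightarrow> real mat \<Rightarrow>
   real mat \<Rightarrow> real mat \<Rightarrow> real mat \<Rightarrow> real mat \<Rightarrow> lin_sys" where
  "split_sys A B1 B2 C1 C2 D11 D12 D21 D22 =
     \<lparr> sysA = A, sysB = B1 @\<^sub>c B2, sysC = C1 @\<^sub>r C2, sysD = four_block_mat D11 D12 D21 D22 \<rparr>"

text \<open>
  The split is into halves of equal dimension. The value \<^term>\<open>None\<close> means that the
  chain transform does not exist.
\<close>

definition chain :: "lin_sys \<Rightarrow> lin_sys option" where
  "chain S =
    (let A = sysA S; n = dim_row A; h = dim_row (sysD S) div 2;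
         (B1, B2, _, _) = split_block (sysB S) n h;
         (C1, _, C2, _) = split_block (sysC S) h n;
         (D11, D12, D21, D22) = split_block (sysD S) h h
     in if invertible_mat D21 then
          let E = the (mat_inverse D21) in
          Some (split_sys
            (A - B1 * E * C2)
            (B2 - B1 * E * D22) (B1 * E)
            (C1 - D11 * E * C2) (- (E * C2))
            (D12 - D11 * E * D22) (D11 * E)
            (- (E * D22))         E)
        else None)"

definition cascade :: "lin_sys \<Rightarrow> lin_sys \<Rightarrow> lin_sys" where
  "cascade Sa Sb =
     \<lparr> sysA = four_block_mat (sysA Sa) (sysB Sa * sysC Sb)
                (0\<^sub>m (dim_row (sysA Sb)) (dim_row (sysA Sa))) (sysA Sb),
       sysB = (sysB Sa * sysD Sb) @\<^sub>r sysB Sb,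
       sysC = sysC Sa @\<^sub>c (sysD Sa * sysC Sb),
       sysD = sysD Sa * sysD Sb \<rparr>"

text \<open>
  Signals are continuous on the time interval \<open>T\<close>, which makes the state trajectories
  continuously differentiable classical solutions. The type \<^typ>\<open>real vec\<close> carries no
  topology, hence the componentwise formulation. Only the values on \<open>T\<close> matter; at an
  end point contained in \<open>T\<close> the derivative is one-sided.
\<close>

definition signal_on :: "real set \<Rightarrow> nat \<Rightarrow> (real \<Rightarrow> real vec) \<Rightarrow> bool" where
  "signal_on T d u \<longleftrightarrow>
     (\<forall>t\<in>T. u t \<in> carrier_vec d) \<and> (\<forall>i<d. continuous_on T (\<lambda>t. vec_index (u t) i))"

definition trajectory_on ::
  "real set \<Rightarrow> lin_sys \<Rightarrow> (real \<Rightarrow> real vec) \<Rightarrow> (real \<Rightarrow> real vec) \<Rightarrow> (real \<Rightarrow> real vec) \<Rightarrow> bool" where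
  "trajectory_on T S u x y \<longleftrightarrow>
     signal_on T (dim_col (sysB S)) u \<and>
     signal_on T (dim_row (sysA S)) x \<and>
     signal_on T (dim_row (sysC S)) y \<and>
     (\<forall>t\<in>T. \<forall>i<dim_row (sysA S).
        ((\<lambda>s. vec_index (x s) i) has_real_derivative
           vec_index (sysA S *\<^sub>v x t + sysB S *\<^sub>v u t) i) (at t within T)) \<and>
     (\<forall>t\<in>T. y t = sysC S *\<^sub>v x t + sysD S *\<^sub>v u t)"

definition is_output_on ::
  "real set \<Rightarrow> lin_sys \<Rightarrow> (real \<Rightarrow> real vec) \<Rightarrow> (real \<Rightarrow> real vec) \<Rightarrow> bool" where
  "is_output_on T S u y \<longleftrightarrow> (\<exists>x. trajectory_on T S u x y)"

lemma chain_split_sys: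
  assumes "A \<in> carrier_mat n n"
    and "B1 \<in> carrier_mat n h" "B2 \<in> carrier_mat n h"
    and "C1 \<in> carrier_mat h n" "C2 \<in> carrier_mat h n"
    and "D11 \<in> carrier_mat h h" "D12 \<in> carrier_mat h h"
    and "D21 \<in> carrier_mat h h" "D22 \<in> carrier_mat h h"
  shows "chain (split_sys A B1 B2 C1 C2 D11 D12 D21 D22) =
    (if invertible_mat D21 then
       let E = the (mat_inverse D21) in
       Some (split_sys
         (A - B1 * E * C2)
         (B2 - B1 * E * D22) (B1 * E)
         (C1 - D11 * E * C2) (- (E * C2))
         (D12 - D11 * E * D22) (D11 * E)
         (- (E * D22))         E)
     else None)"
proof -
  have B: "split_block (B1 @\<^sub>c B2) n h = (B1, B2, 0\<^sub>m 0 h, 0\<^sub>m 0 h)"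
    using assms by (auto simp: split_block_def append_cols_def Let_def intro!: eq_matI)
  have C: "split_block (C1 @\<^sub>r C2) h n = (C1, 0\<^sub>m h 0, C2, 0\<^sub>m h 0)"
    using assms by (auto simp: split_block_def append_rows_def Let_def intro!: eq_matI)
  have D: "split_block (four_block_mat D11 D12 D21 D22) h h = (D11, D12, D21, D22)"
    using assms by (auto simp: split_block_def Let_def intro!: eq_matI)
  have dims: "dim_row A = n" "dim_row (four_block_mat D11 D12 D21 D22) div 2 = h"
    using assms by auto
  show ?thesis
    by (simp only: chain_def split_sys_def lin_sys.simps dims B C D Let_def prod.case)
qed

end

theory Submission
  imports Defs
begin

text \<open>
  Read as a statement about signals, the chain transform only relabels: provided that \<open>D21\<close>
  is invertible, the second output equation can be solved for the first input, so that
  \<open>(y1, y2)\<close> is an output of \<open>\<Sigma>\<close> for \<open>(u1, u2)\<close> with a certain state trajectory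
  exactly if \<open>(y1, u1)\<close> is an output of the chain transform for \<open>(u2, y2)\<close> with the same
  state trajectory (\<open>trajectory_on_chain\<close>). The cascade product is the series connection, in
  which the output of the second factor drives the first (\<open>is_output_on_cascade\<close>).

  The feedback coupling \<open>u2 = y1'\<close>, \<open>u1' = y2\<close> identifies the input \<open>(u2, y2)\<close> of
  \<open>CHAIN(\<Sigma>p)\<close> with the output \<open>(y1', u1')\<close> of \<open>CHAIN(\<Sigma>q)\<close>. After the
  relabelling the feedback connection is therefore the series connection of the chain transforms,
  with external input \<open>(u2', y2')\<close> and output \<open>(y1, u1)\<close>, and undoing the relabelling gives
  a system with input \<open>(u1, u2')\<close> and output \<open>(y1, y2')\<close>.

  The relabelling can be undone because the chain transform is onto the systems whose lower right
  feedthrough block is invertible (\<open>chain_surj\<close>). For the cascade product of the two chain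
  transforms this block is
  \<open>Dp21\<^sup>-\<^sup>1 (1 - Dp22 Dq11) Dq21\<^sup>-\<^sup>1\<close> (\<open>cascade_chain_D22\<close>), and this is the
  place where the invertibility of \<open>1 - Dp22 Dq11\<close> enters. Hence \<open>\<Sigma>p \<star> \<Sigma>q\<close> is
  a preimage of \<open>CHAIN(\<Sigma>p) * CHAIN(\<Sigma>q)\<close> under the chain transform.
\<close>

section \<open>Inverses of square matrices\<close>

lemma invertible_mat_iff_inverse:
  assumes "M \<in> carrier_mat k k"
  shows "invertible_mat M \<longleftrightarrow> (\<exists>N \<in> carrier_mat k k. M * N = 1\<^sub>m k \<and> N * M = 1\<^sub>m k)"
proof
  assume "invertible_mat M"
  then obtain N where "M * N = 1\<^sub>m k" and N: "N * M = 1\<^sub>m (dim_row N)"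
    using assms unfolding invertible_mat_def inverts_mat_def by auto
  \<comment> \<open>The definition of invertibility fixes neither dimension of the inverse; both are read off
    from the two products.\<close>
  moreover have "dim_row N = k"
    using arg_cong[OF N, of dim_col] assms by simp
  moreover have "dim_col N = k"
    using arg_cong[OF \<open>M * N = 1\<^sub>m k\<close>, of dim_col] by simp
  ultimately show "\<exists>N \<in> carrier_mat k k. M * N = 1\<^sub>m k \<and> N * M = 1\<^sub>m k"
    by auto
next
  assume "\<exists>N \<in> carrier_mat k k. M * N = 1\<^sub>m k \<and> N * M = 1\<^sub>m k"
  then obtain N where "N \<in> carrier_mat k k" "M * N = 1\<^sub>m k" "N * M = 1\<^sub>m k" by blast
  then show "invertible_mat M"
    using assms unfolding invertible_mat_def inverts_mat_def by (auto intro!: exI[of _ N])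
qed

lemma mat_inverse_eqI:
  fixes M N :: "'a::field mat"
  assumes M: "M \<in> carrier_mat k k" and N: "N \<in> carrier_mat k k"
    and MN: "M * N = 1\<^sub>m k" and NM: "N * M = 1\<^sub>m k"
  shows "mat_inverse M = Some N"
proof (cases "mat_inverse M")
  case None
  have "M \<in> Units (ring_mat TYPE('a) k ())"
    using assms unfolding Units_def ring_mat_def by auto
  with mat_inverse(1)[OF M None, of "()"] show ?thesis by simp
next
  case (Some N')
  then have N': "N' \<in> carrier_mat k k" and "N' * M = 1\<^sub>m k"
    using mat_inverse(2)[OF M] by auto
  have "N' = N' * (M * N)" using MN N' by simp
  also have "\<dots> = (N' * M) * N" using assoc_mult_mat[OF N' M N] by simp
  also have "\<dots> = N" using \<open>N' * M = 1\<^sub>m k\<close> N by simp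
  finally show ?thesis using Some by simp
qed

lemma invertible_mat_mult:
  fixes M N :: "'a::field mat"
  assumes M: "M \<in> carrier_mat k k" and N: "N \<in> carrier_mat k k"
    and "invertible_mat M" "invertible_mat N"
  shows "invertible_mat (M * N)"
proof -
  obtain M' where M': "M' \<in> carrier_mat k k" "M * M' = 1\<^sub>m k" "M' * M = 1\<^sub>m k"
    using assms invertible_mat_iff_inverse[OF M] by auto
  obtain N' where N': "N' \<in> carrier_mat k k" "N * N' = 1\<^sub>m k" "N' * N = 1\<^sub>m k"
    using assms invertible_mat_iff_inverse[OF N] by auto
  have "(M * N) * (N' * M') = M * ((N * N') * M')"
    using M N M'(1) N'(1) by (simp add: assoc_mult_mat[where n\<^sub>1=k and n\<^sub>2=k and n\<^sub>3=k and n\<^sub>4=k])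
  also have "\<dots> = 1\<^sub>m k" using N' M' M by simp
  finally have 1: "(M * N) * (N' * M') = 1\<^sub>m k" .
  have "(N' * M') * (M * N) = N' * ((M' * M) * N)"
    using M N M'(1) N'(1) by (simp add: assoc_mult_mat[where n\<^sub>1=k and n\<^sub>2=k and n\<^sub>3=k and n\<^sub>4=k])
  also have "\<dots> = 1\<^sub>m k" using N' M' N by simp
  finally have 2: "(N' * M') * (M * N) = 1\<^sub>m k" .
  have MN: "M * N \<in> carrier_mat k k" and "N' * M' \<in> carrier_mat k k"
    using M N M'(1) N'(1) by auto
  then show ?thesis using invertible_mat_iff_inverse[OF MN] 1 2 by blast
qed

section \<open>Systems with split input and output\<close>

definition conformal_blocks ::
  "nat \<Rightarrow> nat \<Rightarrow> real mat \<Rightarrow> real mat \<Rightarrow> real mat \<Rightarrow> real mat \<Rightarrow> real mat \<Rightarrow>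
   real mat \<Rightarrow> real mat \<Rightarrow> real mat \<Rightarrow> real mat \<Rightarrow> bool" where
  "conformal_blocks n h A B1 B2 C1 C2 D11 D12 D21 D22 \<longleftrightarrow>
     A \<in> carrier_mat n n \<and> B1 \<in> carrier_mat n h \<and> B2 \<in> carrier_mat n h \<and>
     C1 \<in> carrier_mat h n \<and> C2 \<in> carrier_mat h n \<and>
     D11 \<in> carrier_mat h h \<and> D12 \<in> carrier_mat h h \<and>
     D21 \<in> carrier_mat h h \<and> D22 \<in> carrier_mat h h"

lemma carrier_append_cols:
  "M \<in> carrier_mat n k \<Longrightarrow> N \<in> carrier_mat n l \<Longrightarrow> M @\<^sub>c N \<in> carrier_mat n (k + l)"
  unfolding append_cols_def carrier_mat_def by auto

lemma append_cols_mult_append_vec: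
  assumes "M \<in> carrier_mat n k" "N \<in> carrier_mat n l" "a \<in> carrier_vec k" "b \<in> carrier_vec l"
  shows "(M @\<^sub>c N) *\<^sub>v (a @\<^sub>v b) = M *\<^sub>v a + N *\<^sub>v b"
proof -
  have "(M @\<^sub>c N) *\<^sub>v (a @\<^sub>v b) =
      (M *\<^sub>v a + N *\<^sub>v b) @\<^sub>v (0\<^sub>m 0 k *\<^sub>v a + 0\<^sub>m 0 l *\<^sub>v b)"
    using four_block_mat_mult_vec[OF assms(1,2) _ _ assms(3,4), of "0\<^sub>m 0 k" 0 "0\<^sub>m 0 l"] assms
    unfolding append_cols_def by auto
  also have "\<dots> = M *\<^sub>v a + N *\<^sub>v b"
    using assms by (intro eq_vecI) auto
  finally show ?thesis .
qed

lemma realisation_split_sys: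
  assumes "conformal_blocks n h A B1 B2 C1 C2 D11 D12 D21 D22"
  shows "realisation n (2 * h) (split_sys A B1 B2 C1 C2 D11 D12 D21 D22)"
  using assms carrier_append_cols[of B1 n h B2 h] carrier_append_rows[of C1 h n C2 h]
  unfolding conformal_blocks_def realisation_def split_sys_def by (auto simp: mult_2)

text \<open>
  The chain transform acts on blocks, whereas the cascade product is given by unsplit matrices.
  Whether a system is a chain transform depends on its feedthrough blocks, so these are prescribed
  here; of the other blocks it is enough to know that they exist.
\<close>

lemma realisation_splitE:
  assumes S: "realisation n (2 * h) S"
    and D: "sysD S = four_block_mat D11 D12 D21 D22"
      "D11 \<in> carrier_mat h h" "D12 \<in> carrier_mat h h"
      "D21 \<in> carrier_mat h h" "D22 \<in> carrier_mat h h"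
  obtains A B1 B2 C1 C2 where "conformal_blocks n h A B1 B2 C1 C2 D11 D12 D21 D22"
    and "S = split_sys A B1 B2 C1 C2 D11 D12 D21 D22"
proof -
  have dimB: "dim_row (sysB S) = n + 0" "dim_col (sysB S) = h + h"
    and dimC: "dim_row (sysC S) = h + h" "dim_col (sysC S) = n + 0"
    using S unfolding realisation_def by auto
  obtain B1 B2 B3 B4 where B: "split_block (sysB S) n h = (B1, B2, B3, B4)"
    by (cases "split_block (sysB S) n h")
  obtain C1 C3 C2 C4 where C: "split_block (sysC S) h n = (C1, C3, C2, C4)"
    by (cases "split_block (sysC S) h n")
  note B = split_block[OF B dimB] and C = split_block[OF C dimC]
  have "B3 = 0\<^sub>m 0 h" "B4 = 0\<^sub>m 0 h" "C3 = 0\<^sub>m h 0" "C4 = 0\<^sub>m h 0"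
    using B(3,4) C(2,4) by (auto intro!: eq_matI)
  with B C have eqs: "sysB S = B1 @\<^sub>c B2" "sysC S = C1 @\<^sub>r C2"
    unfolding append_cols_def append_rows_def by auto
  show thesis
  proof
    show "conformal_blocks n h (sysA S) B1 B2 C1 C2 D11 D12 D21 D22"
      using S B C D unfolding conformal_blocks_def realisation_def by simp
    show "S = split_sys (sysA S) B1 B2 C1 C2 D11 D12 D21 D22"
      using eqs D unfolding split_sys_def by simp
  qed
qed

lemma signal_on_dim_vec: "signal_on T d u \<Longrightarrow> t \<in> T \<Longrightarrow> dim_vec (u t) = d"
  unfolding signal_on_def by auto

lemma signal_on_append_vec:
  assumes "signal_on T k u" "signal_on T l v"
  shows "signal_on T (k + l) (\<lambda>t. u t @\<^sub>v v t)"
  unfolding signal_on_def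
proof (intro conjI ballI allI impI)
  fix t assume "t \<in> T"
  then show "u t @\<^sub>v v t \<in> carrier_vec (k + l)"
    using assms unfolding signal_on_def by auto
next
  fix i assume i: "i < k + l"
  have eq: "vec_index (u t @\<^sub>v v t) i = (if i < k then vec_index (u t) i else vec_index (v t) (i - k))"
    if "t \<in> T" for t
    using signal_on_dim_vec[OF assms(1) that] signal_on_dim_vec[OF assms(2) that] i by simp
  have "continuous_on T (\<lambda>t. if i < k then vec_index (u t) i else vec_index (v t) (i - k))"
    using assms i unfolding signal_on_def by (cases "i < k") auto
  then show "continuous_on T (\<lambda>t. vec_index (u t @\<^sub>v v t) i)"
    by (subst continuous_on_cong[OF refl eq])
qed

text \<open>
  The equations of a split system, separated into the state equation and one equation for each half
  of the output. All arguments about the chain transform take place on this form.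
\<close>

lemma trajectory_on_split_sys:
  assumes S: "conformal_blocks n h A B1 B2 C1 C2 D11 D12 D21 D22"
    and u: "signal_on T h u1" "signal_on T h u2"
    and y: "signal_on T h y1" "signal_on T h y2"
  shows "trajectory_on T (split_sys A B1 B2 C1 C2 D11 D12 D21 D22)
      (\<lambda>t. u1 t @\<^sub>v u2 t) x (\<lambda>t. y1 t @\<^sub>v y2 t) \<longleftrightarrow>
    signal_on T n x \<and> (\<forall>t\<in>T.
      (\<forall>i<n. ((\<lambda>s. vec_index (x s) i) has_real_derivative
         vec_index (A *\<^sub>v x t + (B1 *\<^sub>v u1 t + B2 *\<^sub>v u2 t)) i) (at t within T)) \<and>
      y1 t = C1 *\<^sub>v x t + (D11 *\<^sub>v u1 t + D12 *\<^sub>v u2 t) \<and>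
      y2 t = C2 *\<^sub>v x t + (D21 *\<^sub>v u1 t + D22 *\<^sub>v u2 t))"
    (is "trajectory_on T ?S ?u x ?y \<longleftrightarrow> ?R")
proof -
  have c: "A \<in> carrier_mat n n" "B1 \<in> carrier_mat n h" "B2 \<in> carrier_mat n h"
    "C1 \<in> carrier_mat h n" "C2 \<in> carrier_mat h n"
    "D11 \<in> carrier_mat h h" "D12 \<in> carrier_mat h h"
    "D21 \<in> carrier_mat h h" "D22 \<in> carrier_mat h h"
    using S unfolding conformal_blocks_def by auto
  have dims: "dim_row (sysA ?S) = n" "dim_col (sysB ?S) = h + h" "dim_row (sysC ?S) = h + h"
    using realisation_split_sys[OF S] unfolding realisation_def by auto
  have io: "signal_on T (h + h) ?u" "signal_on T (h + h) ?y"
    using u y by (auto intro: signal_on_append_vec)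
  have B: "sysB ?S *\<^sub>v ?u t = B1 *\<^sub>v u1 t + B2 *\<^sub>v u2 t" if "t \<in> T" for t
    using that u append_cols_mult_append_vec[OF c(2,3)]
    unfolding signal_on_def split_sys_def by simp
  have out: "?y t = sysC ?S *\<^sub>v x t + sysD ?S *\<^sub>v ?u t \<longleftrightarrow>
      y1 t = C1 *\<^sub>v x t + (D11 *\<^sub>v u1 t + D12 *\<^sub>v u2 t) \<and>
      y2 t = C2 *\<^sub>v x t + (D21 *\<^sub>v u1 t + D22 *\<^sub>v u2 t)"
    if t: "t \<in> T" and x: "signal_on T n x" for t
  proof -
    have v: "u1 t \<in> carrier_vec h" "u2 t \<in> carrier_vec h" "x t \<in> carrier_vec n"
      "y1 t \<in> carrier_vec h" "y2 t \<in> carrier_vec h"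
      using u y x t unfolding signal_on_def by auto
    have "sysC ?S *\<^sub>v x t + sysD ?S *\<^sub>v ?u t =
      ((C1 *\<^sub>v x t) @\<^sub>v (C2 *\<^sub>v x t)) +
      ((D11 *\<^sub>v u1 t + D12 *\<^sub>v u2 t) @\<^sub>v (D21 *\<^sub>v u1 t + D22 *\<^sub>v u2 t))"
      using mat_mult_append[OF c(4,5) v(3)] four_block_mat_mult_vec[OF c(6-9) v(1,2)]
      unfolding split_sys_def by simp
    also have "\<dots> = (C1 *\<^sub>v x t + (D11 *\<^sub>v u1 t + D12 *\<^sub>v u2 t)) @\<^sub>v
      (C2 *\<^sub>v x t + (D21 *\<^sub>v u1 t + D22 *\<^sub>v u2 t))"
      using c v by (intro eq_vecI) auto
    finally show ?thesis
      using c v append_vec_eq[of "y1 t" h "C1 *\<^sub>v x t + (D11 *\<^sub>v u1 t + D12 *\<^sub>v u2 t)"] by simp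
  qed
  have A: "sysA ?S = A" unfolding split_sys_def by simp
  show ?thesis
    unfolding trajectory_on_def dims
    using io B out by (auto simp: A)
qed

section \<open>The chain transform interchanges two signals\<close>

lemma chain_split_sys_Some:
  assumes S: "conformal_blocks n h A B1 B2 C1 C2 D11 D12 D21 D22"
    and E: "E \<in> carrier_mat h h" "D21 * E = 1\<^sub>m h" "E * D21 = 1\<^sub>m h"
  shows "chain (split_sys A B1 B2 C1 C2 D11 D12 D21 D22) =
    Some (split_sys (A - B1 * E * C2) (B2 - B1 * E * D22) (B1 * E)
      (C1 - D11 * E * C2) (- (E * C2))
      (D12 - D11 * E * D22) (D11 * E) (- (E * D22)) E)"
proof -
  have c: "A \<in> carrier_mat n n" "B1 \<in> carrier_mat n h" "B2 \<in> carrier_mat n h"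
    "C1 \<in> carrier_mat h n" "C2 \<in> carrier_mat h n"
    "D11 \<in> carrier_mat h h" "D12 \<in> carrier_mat h h"
    "D21 \<in> carrier_mat h h" "D22 \<in> carrier_mat h h"
    using S unfolding conformal_blocks_def by auto
  have "invertible_mat D21" using invertible_mat_iff_inverse[OF c(8)] E by blast
  moreover have "mat_inverse D21 = Some E" using mat_inverse_eqI[OF c(8) E] .
  ultimately show ?thesis using chain_split_sys[OF c] by simp
qed

lemma conformal_blocks_chain:
  assumes "conformal_blocks n h A B1 B2 C1 C2 D11 D12 D21 D22" and "E \<in> carrier_mat h h"
  shows "conformal_blocks n h (A - B1 * E * C2) (B2 - B1 * E * D22) (B1 * E)
      (C1 - D11 * E * C2) (- (E * C2))
      (D12 - D11 * E * D22) (D11 * E) (- (E * D22)) E"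
  using assms unfolding conformal_blocks_def by auto

text \<open>
  The right-hand side is the row of the chain transform that produces \<open>u1\<close>: the second output
  equation, multiplied by the inverse \<open>E\<close> of \<open>D21\<close>.
\<close>

lemma solve_for_input:
  fixes E F W Z :: "real mat"
  assumes c: "E \<in> carrier_mat h h" "F \<in> carrier_mat h h" "W \<in> carrier_mat h h" "Z \<in> carrier_mat h n"
    and v: "x \<in> carrier_vec n" "u \<in> carrier_vec h" "w \<in> carrier_vec h" "y \<in> carrier_vec h"
    and E: "F * E = 1\<^sub>m h" "E * F = 1\<^sub>m h"
  shows "y = Z *\<^sub>v x + (F *\<^sub>v u + W *\<^sub>v w) \<longleftrightarrow>
    u = - (E * Z) *\<^sub>v x + (- (E * W) *\<^sub>v w + E *\<^sub>v y)"
proof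
  assume y: "y = Z *\<^sub>v x + (F *\<^sub>v u + W *\<^sub>v w)"
  have "E *\<^sub>v y = E *\<^sub>v (Z *\<^sub>v x) + (E *\<^sub>v (F *\<^sub>v u) + E *\<^sub>v (W *\<^sub>v w))"
    unfolding y using c v by (simp add: mult_add_distrib_mat_vec[where nr=h and nc=h])
  also have "E *\<^sub>v (F *\<^sub>v u) = u"
    using c v E by (simp flip: assoc_mult_mat_vec[where n\<^sub>1=h and n\<^sub>2=h and n\<^sub>3=h])
  finally show "u = - (E * Z) *\<^sub>v x + (- (E * W) *\<^sub>v w + E *\<^sub>v y)"
    using c v by (intro eq_vecI) (auto simp: assoc_mult_mat_vec[where n\<^sub>1=h and n\<^sub>2=h])
next
  assume u: "u = - (E * Z) *\<^sub>v x + (- (E * W) *\<^sub>v w + E *\<^sub>v y)"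
  have "u = E *\<^sub>v (y - (Z *\<^sub>v x + W *\<^sub>v w))"
    unfolding u using c v
    by (intro eq_vecI) (auto simp: assoc_mult_mat_vec[where n\<^sub>1=h and n\<^sub>2=h]
        mult_minus_distrib_mat_vec[where nr=h and nc=h] mult_add_distrib_mat_vec[where nr=h and nc=h])
  then have "F *\<^sub>v u = y - (Z *\<^sub>v x + W *\<^sub>v w)"
    using c v E by (simp flip: assoc_mult_mat_vec[where n\<^sub>1=h and n\<^sub>2=h and n\<^sub>3=h])
  then show "y = Z *\<^sub>v x + (F *\<^sub>v u + W *\<^sub>v w)"
    using c v by (intro eq_vecI) auto
qed

text \<open>
  With the solved input inserted, the state equation and the first output equation become rows of
  the chain transform. Both have the form \<open>X x + Y u + V w\<close>, so one calculation covers them.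
\<close>

lemma eliminate_input:
  fixes E V W X Y Z :: "real mat"
  assumes c: "E \<in> carrier_mat h h" "W \<in> carrier_mat h h" "Z \<in> carrier_mat h n"
      "X \<in> carrier_mat k n" "Y \<in> carrier_mat k h" "V \<in> carrier_mat k h"
    and v: "x \<in> carrier_vec n" "w \<in> carrier_vec h" "y \<in> carrier_vec h"
    and u: "u = - (E * Z) *\<^sub>v x + (- (E * W) *\<^sub>v w + E *\<^sub>v y)"
  shows "X *\<^sub>v x + (Y *\<^sub>v u + V *\<^sub>v w) =
    (X - Y * E * Z) *\<^sub>v x + ((V - Y * E * W) *\<^sub>v w + Y * E *\<^sub>v y)"
proof -
  have "u = E *\<^sub>v (y - (Z *\<^sub>v x + W *\<^sub>v w))"
    unfolding u using c v
    by (intro eq_vecI) (auto simp: assoc_mult_mat_vec[where n\<^sub>1=h and n\<^sub>2=h]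
        mult_minus_distrib_mat_vec[where nr=h and nc=h] mult_add_distrib_mat_vec[where nr=h and nc=h])
  then have "Y *\<^sub>v u = (Y * E) *\<^sub>v (y - (Z *\<^sub>v x + W *\<^sub>v w))"
    using c v by (simp add: assoc_mult_mat_vec[where n\<^sub>1=k and n\<^sub>2=h and n\<^sub>3=h])
  also have "\<dots> = Y * E *\<^sub>v y - ((Y * E * Z) *\<^sub>v x + (Y * E * W) *\<^sub>v w)"
    using c v by (simp add: mult_minus_distrib_mat_vec[where nr=k and nc=h]
        mult_add_distrib_mat_vec[where nr=k and nc=h]
        assoc_mult_mat_vec[where n\<^sub>1=k and n\<^sub>2=h and A="Y * E"] del: assoc_mult_mat)
  finally have Yu: "Y *\<^sub>v u = Y * E *\<^sub>v y - ((Y * E * Z) *\<^sub>v x + (Y * E * W) *\<^sub>v w)" .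
  note minus_mult_distrib_mat_vec[OF c(4) mult_carrier_mat[OF mult_carrier_mat[OF c(5,1)] c(3)] v(1)]
    minus_mult_distrib_mat_vec[OF c(6) mult_carrier_mat[OF mult_carrier_mat[OF c(5,1)] c(2)] v(2)]
  then show ?thesis
    unfolding Yu using c v
    by (intro eq_vecI) (auto simp del: assoc_mult_mat assoc_mult_mat_vec)
qed

text \<open>
  Interchanging \<open>u1\<close> and \<open>y2\<close> is a pointwise equivalence of equations, because solving for
  \<open>u1\<close> loses no information when \<open>D21\<close> is invertible. The state trajectory stays the
  same.
\<close>

lemma trajectory_on_chain:
  assumes S: "conformal_blocks n h A B1 B2 C1 C2 D11 D12 D21 D22"
    and inv: "invertible_mat D21"
    and chain: "chain (split_sys A B1 B2 C1 C2 D11 D12 D21 D22) = Some \<Gamma>"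
    and u: "signal_on T h u1" "signal_on T h u2"
    and y: "signal_on T h y1" "signal_on T h y2"
  shows "trajectory_on T (split_sys A B1 B2 C1 C2 D11 D12 D21 D22)
      (\<lambda>t. u1 t @\<^sub>v u2 t) x (\<lambda>t. y1 t @\<^sub>v y2 t) \<longleftrightarrow>
    trajectory_on T \<Gamma> (\<lambda>t. u2 t @\<^sub>v y2 t) x (\<lambda>t. y1 t @\<^sub>v u1 t)"
proof -
  have c: "A \<in> carrier_mat n n" "B1 \<in> carrier_mat n h" "B2 \<in> carrier_mat n h"
    "C1 \<in> carrier_mat h n" "C2 \<in> carrier_mat h n"
    "D11 \<in> carrier_mat h h" "D12 \<in> carrier_mat h h"
    "D21 \<in> carrier_mat h h" "D22 \<in> carrier_mat h h"
    using S unfolding conformal_blocks_def by auto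
  obtain E where E: "E \<in> carrier_mat h h" "D21 * E = 1\<^sub>m h" "E * D21 = 1\<^sub>m h"
    using inv invertible_mat_iff_inverse[OF c(8)] by auto
  have \<Gamma>: "\<Gamma> = split_sys (A - B1 * E * C2) (B2 - B1 * E * D22) (B1 * E)
      (C1 - D11 * E * C2) (- (E * C2))
      (D12 - D11 * E * D22) (D11 * E) (- (E * D22)) E"
    using chain chain_split_sys_Some[OF S E] by simp
  have solve: "y2 t = C2 *\<^sub>v x t + (D21 *\<^sub>v u1 t + D22 *\<^sub>v u2 t) \<longleftrightarrow>
      u1 t = - (E * C2) *\<^sub>v x t + (- (E * D22) *\<^sub>v u2 t + E *\<^sub>v y2 t)"
    if "t \<in> T" "signal_on T n x" for t
    using that u y unfolding signal_on_def
    by (intro solve_for_input[OF E(1) c(8,9,5) _ _ _ _ E(2,3)]) auto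
  have elim: "A *\<^sub>v x t + (B1 *\<^sub>v u1 t + B2 *\<^sub>v u2 t) = (A - B1 * E * C2) *\<^sub>v x t +
        ((B2 - B1 * E * D22) *\<^sub>v u2 t + B1 * E *\<^sub>v y2 t)"
      "C1 *\<^sub>v x t + (D11 *\<^sub>v u1 t + D12 *\<^sub>v u2 t) = (C1 - D11 * E * C2) *\<^sub>v x t +
        ((D12 - D11 * E * D22) *\<^sub>v u2 t + D11 * E *\<^sub>v y2 t)"
    if "t \<in> T" "signal_on T n x"
      "u1 t = - (E * C2) *\<^sub>v x t + (- (E * D22) *\<^sub>v u2 t + E *\<^sub>v y2 t)" for t
  proof -
    have v: "x t \<in> carrier_vec n" "u2 t \<in> carrier_vec h" "y2 t \<in> carrier_vec h"
      using that(1,2) u y unfolding signal_on_def by auto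
    show "A *\<^sub>v x t + (B1 *\<^sub>v u1 t + B2 *\<^sub>v u2 t) = (A - B1 * E * C2) *\<^sub>v x t +
        ((B2 - B1 * E * D22) *\<^sub>v u2 t + B1 * E *\<^sub>v y2 t)"
      using eliminate_input[OF E(1) c(9,5,1,2,3) v that(3)] .
    show "C1 *\<^sub>v x t + (D11 *\<^sub>v u1 t + D12 *\<^sub>v u2 t) = (C1 - D11 * E * C2) *\<^sub>v x t +
        ((D12 - D11 * E * D22) *\<^sub>v u2 t + D11 * E *\<^sub>v y2 t)"
      using eliminate_input[OF E(1) c(9,5,4,6,7) v that(3)] .
  qed
  show ?thesis
    unfolding \<Gamma> trajectory_on_split_sys[OF S u y]
      trajectory_on_split_sys[OF conformal_blocks_chain[OF S E(1)] u(2) y(2) y(1) u(1)]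
  proof (rule conj_cong[OF refl], rule ball_cong[OF refl])
    fix t assume x: "signal_on T n x" and t: "t \<in> T"
    show "(\<forall>i<n. ((\<lambda>s. vec_index (x s) i) has_real_derivative
          vec_index (A *\<^sub>v x t + (B1 *\<^sub>v u1 t + B2 *\<^sub>v u2 t)) i) (at t within T)) \<and>
        y1 t = C1 *\<^sub>v x t + (D11 *\<^sub>v u1 t + D12 *\<^sub>v u2 t) \<and>
        y2 t = C2 *\<^sub>v x t + (D21 *\<^sub>v u1 t + D22 *\<^sub>v u2 t) \<longleftrightarrow>
      (\<forall>i<n. ((\<lambda>s. vec_index (x s) i) has_real_derivative
          vec_index ((A - B1 * E * C2) *\<^sub>v x t +
            ((B2 - B1 * E * D22) *\<^sub>v u2 t + B1 * E *\<^sub>v y2 t)) i) (at t within T)) \<and>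
        y1 t = (C1 - D11 * E * C2) *\<^sub>v x t +
          ((D12 - D11 * E * D22) *\<^sub>v u2 t + D11 * E *\<^sub>v y2 t) \<and>
        u1 t = - (E * C2) *\<^sub>v x t + (- (E * D22) *\<^sub>v u2 t + E *\<^sub>v y2 t)"
    \<comment> \<open>The solved equation is a conjunct on both sides, so the substitution is made only where it
      holds; where it fails, both sides are false.\<close>
    proof (cases "u1 t = - (E * C2) *\<^sub>v x t + (- (E * D22) *\<^sub>v u2 t + E *\<^sub>v y2 t)")
      case True
      show ?thesis unfolding elim[OF t x True] solve[OF t x] by (rule refl)
    next
      case False
      then show ?thesis unfolding solve[OF t x] by blast
    qed
  qed
qed

lemma is_output_on_chain:
  assumes "conformal_blocks n h A B1 B2 C1 C2 D11 D12 D21 D22"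
    and "invertible_mat D21"
    and "chain (split_sys A B1 B2 C1 C2 D11 D12 D21 D22) = Some \<Gamma>"
    and "signal_on T h u1" "signal_on T h u2" "signal_on T h y1" "signal_on T h y2"
  shows "is_output_on T (split_sys A B1 B2 C1 C2 D11 D12 D21 D22)
      (\<lambda>t. u1 t @\<^sub>v u2 t) (\<lambda>t. y1 t @\<^sub>v y2 t) \<longleftrightarrow>
    is_output_on T \<Gamma> (\<lambda>t. u2 t @\<^sub>v y2 t) (\<lambda>t. y1 t @\<^sub>v u1 t)"
  unfolding is_output_on_def using trajectory_on_chain[OF assms] by blast

section \<open>Realising a system as a chain transform\<close>

text \<open>
  The chain transform subtracts \<open>Y F E (- F Z)\<close> from a block from which its inverse has
  subtracted \<open>Y F Z\<close>. The four blocks of the form \<open>V - Y F Z\<close> in \<open>chain_surj\<close> are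
  instances.
\<close>

lemma chain_block_cancel:
  fixes E F V Y Z :: "real mat"
  assumes c: "E \<in> carrier_mat h h" "F \<in> carrier_mat h h"
      "Z \<in> carrier_mat h l" "V \<in> carrier_mat k l" "Y \<in> carrier_mat k h"
    and "F * E = 1\<^sub>m h"
  shows "V - Y * F * Z - Y * F * E * (- (F * Z)) = V"
proof -
  have "Y * F * E = Y" using assms by (simp add: assoc_mult_mat[where n\<^sub>1=k and n\<^sub>2=h and n\<^sub>3=h and n\<^sub>4=h])
  then show ?thesis
    using c by (intro eq_matI) (auto simp: assoc_mult_mat[where n\<^sub>1=k and n\<^sub>2=h and n\<^sub>3=h and n\<^sub>4=l])
qed

text \<open>
  The preimage is found by solving the last row of the given system, which reads
  \<open>u1 = C2 x + D21 u2 + D22 y2\<close> in terms of the signals of the preimage, for \<open>y2\<close> with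
  \<open>F\<close> the inverse of \<open>D22\<close>, and inserting the result in the other rows. Its block
  \<open>D21'\<close> is \<open>F\<close>.
\<close>

lemma chain_surj:
  assumes G: "conformal_blocks n h A B1 B2 C1 C2 D11 D12 D21 D22"
    and inv: "invertible_mat D22"
  obtains A' B1' B2' C1' C2' D11' D12' D21' D22'
  where "conformal_blocks n h A' B1' B2' C1' C2' D11' D12' D21' D22'"
    and "invertible_mat D21'"
    and "chain (split_sys A' B1' B2' C1' C2' D11' D12' D21' D22') =
      Some (split_sys A B1 B2 C1 C2 D11 D12 D21 D22)"
proof -
  have c: "A \<in> carrier_mat n n" "B1 \<in> carrier_mat n h" "B2 \<in> carrier_mat n h"
    "C1 \<in> carrier_mat h n" "C2 \<in> carrier_mat h n"
    "D11 \<in> carrier_mat h h" "D12 \<in> carrier_mat h h"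
    "D21 \<in> carrier_mat h h" "D22 \<in> carrier_mat h h"
    using G unfolding conformal_blocks_def by auto
  obtain F where F: "F \<in> carrier_mat h h" "D22 * F = 1\<^sub>m h" "F * D22 = 1\<^sub>m h"
    using inv invertible_mat_iff_inverse[OF c(9)] by auto
  have S: "conformal_blocks n h (A - B2 * F * C2) (B2 * F) (B1 - B2 * F * D21)
      (C1 - D12 * F * C2) (- (F * C2)) (D12 * F) (D11 - D12 * F * D21) F (- (F * D21))"
    using c F unfolding conformal_blocks_def by auto
  have right: "X * F * D22 = X" if "X \<in> carrier_mat k h" for X k
    using that c F by (simp add: assoc_mult_mat[where n\<^sub>1=k and n\<^sub>2=h and n\<^sub>3=h and n\<^sub>4=h])
  have left: "- (D22 * - (F * X)) = X" if "X \<in> carrier_mat h k" for X k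
  proof -
    have "D22 * (F * X) = X"
      using that c F by (simp flip: assoc_mult_mat[where n\<^sub>1=h and n\<^sub>2=h and n\<^sub>3=h and n\<^sub>4=k])
    then show ?thesis using that c F by simp
  qed
  note cancel = chain_block_cancel[OF c(9) F(1) _ _ _ F(3)]
  have "chain (split_sys (A - B2 * F * C2) (B2 * F) (B1 - B2 * F * D21)
      (C1 - D12 * F * C2) (- (F * C2)) (D12 * F) (D11 - D12 * F * D21) F (- (F * D21))) =
      Some (split_sys A B1 B2 C1 C2 D11 D12 D21 D22)"
    unfolding chain_split_sys_Some[OF S c(9) F(3,2)]
    using cancel[OF c(5,1,3)] cancel[OF c(8,2,3)] cancel[OF c(5,4,7)] cancel[OF c(8,6,7)]
      right[OF c(3)] right[OF c(7)] left[OF c(5)] left[OF c(8)] by simp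
  moreover have "invertible_mat F" using invertible_mat_iff_inverse[OF F(1)] F c(9) by blast
  ultimately show thesis using that[OF S] by blast
qed

section \<open>The cascade product is the series connection\<close>

lemma realisation_cascade:
  assumes "realisation na m Sa" "realisation nb m Sb"
  shows "realisation (na + nb) m (cascade Sa Sb)"
  using assms carrier_append_rows[of "sysB Sa * sysD Sb" na m "sysB Sb" nb]
    carrier_append_cols[of "sysC Sa" m na "sysD Sa * sysC Sb" nb]
  unfolding realisation_def cascade_def by auto

lemma signal_on_mult_mat_vec:
  assumes M: "M \<in> carrier_mat k l" and u: "signal_on T l u"
  shows "signal_on T k (\<lambda>t. M *\<^sub>v u t)"
  unfolding signal_on_def
proof (intro conjI ballI allI impI)
  fix t assume "t \<in> T" then show "M *\<^sub>v u t \<in> carrier_vec k"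
    using M u unfolding signal_on_def by auto
next
  fix i assume "i < k"
  have "continuous_on T (\<lambda>t. \<Sum>j<l. M $$ (i, j) * vec_index (u t) j)"
    using u unfolding signal_on_def by (auto intro!: continuous_intros)
  moreover have eq: "vec_index (M *\<^sub>v u t) i = (\<Sum>j<l. M $$ (i, j) * vec_index (u t) j)" if "t \<in> T" for t
  proof -
    show ?thesis using signal_on_dim_vec[OF u that] M \<open>i < k\<close> by (simp add: scalar_prod_def atLeast0LessThan)
  qed
  ultimately show "continuous_on T (\<lambda>t. vec_index (M *\<^sub>v u t) i)"
    by (subst continuous_on_cong[OF refl eq])
qed

lemma signal_on_add_vec:
  assumes "signal_on T k u" "signal_on T k v"
  shows "signal_on T k (\<lambda>t. u t + v t)"
  unfolding signal_on_def
proof (intro conjI ballI allI impI)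
  fix t assume "t \<in> T" then show "u t + v t \<in> carrier_vec k"
    using assms unfolding signal_on_def by auto
next
  fix i assume "i < k"
  have "continuous_on T (\<lambda>t. vec_index (u t) i + vec_index (v t) i)"
    using assms \<open>i < k\<close> unfolding signal_on_def by (auto intro!: continuous_intros)
  moreover have eq: "vec_index (u t + v t) i = vec_index (u t) i + vec_index (v t) i" if "t \<in> T" for t
    using signal_on_dim_vec[OF assms(2) that] \<open>i < k\<close> by simp
  ultimately show "continuous_on T (\<lambda>t. vec_index (u t + v t) i)"
    by (subst continuous_on_cong[OF refl eq])
qed

lemma signal_on_subvector:
  assumes "signal_on T d u" and "k + l \<le> d"
  shows "signal_on T l (\<lambda>t. vec l (\<lambda>i. vec_index (u t) (k + i)))"
  using assms unfolding signal_on_def by auto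

lemma signal_on_cong:
  assumes "\<And>t. t \<in> T \<Longrightarrow> u t = v t"
  shows "signal_on T d u \<longleftrightarrow> signal_on T d v"
  using assms unfolding signal_on_def by (simp cong: continuous_on_cong)

lemma is_output_on_cong:
  assumes "\<And>t. t \<in> T \<Longrightarrow> u t = v t" "\<And>t. t \<in> T \<Longrightarrow> y t = z t"
  shows "is_output_on T S u y \<longleftrightarrow> is_output_on T S v z"
  unfolding is_output_on_def trajectory_on_def
  using assms by (simp cong: signal_on_cong)

text \<open>
  The block triangular matrices of the cascade product are the result of substituting the output
  equation of \<open>Sb\<close> for the input \<open>v\<close> of \<open>Sa\<close>.
\<close>

lemma cascade_equations:
  assumes Sa: "realisation na m Sa" and Sb: "realisation nb m Sb"
    and xa: "xa \<in> carrier_vec na" and xb: "xb \<in> carrier_vec nb" and u: "u \<in> carrier_vec m"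
    and v: "v = sysC Sb *\<^sub>v xb + sysD Sb *\<^sub>v u"
  shows "sysA (cascade Sa Sb) *\<^sub>v (xa @\<^sub>v xb) + sysB (cascade Sa Sb) *\<^sub>v u =
      (sysA Sa *\<^sub>v xa + sysB Sa *\<^sub>v v) @\<^sub>v (sysA Sb *\<^sub>v xb + sysB Sb *\<^sub>v u)"
    and "sysC (cascade Sa Sb) *\<^sub>v (xa @\<^sub>v xb) + sysD (cascade Sa Sb) *\<^sub>v u =
      sysC Sa *\<^sub>v xa + sysD Sa *\<^sub>v v"
proof -
  have a: "sysA Sa \<in> carrier_mat na na" "sysB Sa \<in> carrier_mat na m"
      "sysC Sa \<in> carrier_mat m na" "sysD Sa \<in> carrier_mat m m"
    and b: "sysA Sb \<in> carrier_mat nb nb" "sysB Sb \<in> carrier_mat nb m"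
      "sysC Sb \<in> carrier_mat m nb" "sysD Sb \<in> carrier_mat m m"
    using Sa Sb unfolding realisation_def by auto
  have feed: "M *\<^sub>v v = (M * sysC Sb) *\<^sub>v xb + (M * sysD Sb) *\<^sub>v u" if "M \<in> carrier_mat k m" for M k
    unfolding v using that b xb u
    by (simp add: mult_add_distrib_mat_vec[where nr=k and nc=m]
        assoc_mult_mat_vec[where n\<^sub>1=k and n\<^sub>2=m])
  have zero: "0\<^sub>m nb na *\<^sub>v xa = 0\<^sub>v nb" using xa by (intro eq_vecI) auto
  have "sysA (cascade Sa Sb) *\<^sub>v (xa @\<^sub>v xb) =
      (sysA Sa *\<^sub>v xa + (sysB Sa * sysC Sb) *\<^sub>v xb) @\<^sub>v (0\<^sub>m nb na *\<^sub>v xa + sysA Sb *\<^sub>v xb)"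
    using four_block_mat_mult_vec[OF a(1) mult_carrier_mat[OF a(2) b(3)] _ b(1) xa xb, of "0\<^sub>m nb na"] a b
    unfolding cascade_def by simp
  moreover have "sysB (cascade Sa Sb) *\<^sub>v u = ((sysB Sa * sysD Sb) *\<^sub>v u) @\<^sub>v (sysB Sb *\<^sub>v u)"
    using mat_mult_append[OF mult_carrier_mat[OF a(2) b(4)] b(2) u]
    unfolding cascade_def by simp
  ultimately show "sysA (cascade Sa Sb) *\<^sub>v (xa @\<^sub>v xb) + sysB (cascade Sa Sb) *\<^sub>v u =
      (sysA Sa *\<^sub>v xa + sysB Sa *\<^sub>v v) @\<^sub>v (sysA Sb *\<^sub>v xb + sysB Sb *\<^sub>v u)"
    unfolding feed[OF a(2)] zero using a b xa xb u
    by (intro eq_vecI) (auto simp del: assoc_mult_mat_vec)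
  have "sysC (cascade Sa Sb) *\<^sub>v (xa @\<^sub>v xb) = sysC Sa *\<^sub>v xa + (sysD Sa * sysC Sb) *\<^sub>v xb"
    using append_cols_mult_append_vec[OF a(3) mult_carrier_mat[OF a(4) b(3)] xa xb]
    unfolding cascade_def by simp
  then show "sysC (cascade Sa Sb) *\<^sub>v (xa @\<^sub>v xb) + sysD (cascade Sa Sb) *\<^sub>v u =
      sysC Sa *\<^sub>v xa + sysD Sa *\<^sub>v v"
    unfolding feed[OF a(4)] using a b xa xb u
    by (intro eq_vecI) (auto simp: cascade_def simp del: assoc_mult_mat_vec)
qed

text \<open>
  The state of the cascade product is the pair of the two states. The intermediate signal \<open>v\<close>
  has to be continuous as an input of \<open>Sa\<close>; it is, being a linear combination of a continuous
  state and a continuous input.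
\<close>

lemma is_output_on_cascade:
  assumes Sa: "realisation na m Sa" and Sb: "realisation nb m Sb"
  shows "is_output_on T (cascade Sa Sb) u y \<longleftrightarrow>
    (\<exists>v. is_output_on T Sa v y \<and> is_output_on T Sb u v)"
proof -
  let ?S = "cascade Sa Sb"
  have dims: "dim_row (sysA Sa) = na" "dim_col (sysB Sa) = m" "dim_row (sysC Sa) = m"
      "dim_row (sysA Sb) = nb" "dim_col (sysB Sb) = m" "dim_row (sysC Sb) = m"
      "dim_row (sysA ?S) = na + nb" "dim_col (sysB ?S) = m" "dim_row (sysC ?S) = m"
    using Sa Sb realisation_cascade[OF Sa Sb] unfolding realisation_def by auto
  have b: "sysC Sb \<in> carrier_mat m nb" "sysD Sb \<in> carrier_mat m m"
    "sysA Sa \<in> carrier_mat na na" "sysB Sa \<in> carrier_mat na m"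
    "sysA Sb \<in> carrier_mat nb nb" "sysB Sb \<in> carrier_mat nb m"
    using Sa Sb unfolding realisation_def by auto
  show ?thesis
  proof
    assume "is_output_on T ?S u y"
    then obtain x where x: "trajectory_on T ?S u x y" unfolding is_output_on_def by auto
    \<comment> \<open>Only the values of \<open>x\<close> on \<open>T\<close> have a known dimension. Both parts are therefore
      given entry by entry, so that their entries are entries of \<open>x\<close> at every time and inherit
      the derivatives without a localisation to \<open>T\<close>.\<close>
    define xa where "xa t = vec na (\<lambda>i. vec_index (x t) (0 + i))" for t
    define xb where "xb t = vec nb (\<lambda>i. vec_index (x t) (na + i))" for t
    define v where "v t = sysC Sb *\<^sub>v xb t + sysD Sb *\<^sub>v u t" for t
    have u: "signal_on T m u" and sx: "signal_on T (na + nb) x" and y: "signal_on T m y"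
      using x unfolding trajectory_on_def dims by auto
    have sa: "signal_on T na xa" and sb: "signal_on T nb xb"
      unfolding xa_def xb_def by (intro signal_on_subvector[OF sx]; simp)+
    have v: "signal_on T m v"
      unfolding v_def by (intro signal_on_add_vec signal_on_mult_mat_vec[OF b(1) sb]
          signal_on_mult_mat_vec[OF b(2) u])
    have eqs: "sysA ?S *\<^sub>v x t + sysB ?S *\<^sub>v u t =
        (sysA Sa *\<^sub>v xa t + sysB Sa *\<^sub>v v t) @\<^sub>v (sysA Sb *\<^sub>v xb t + sysB Sb *\<^sub>v u t)"
      "sysC ?S *\<^sub>v x t + sysD ?S *\<^sub>v u t = sysC Sa *\<^sub>v xa t + sysD Sa *\<^sub>v v t" if t: "t \<in> T" for t
    proof -
      have "x t = xa t @\<^sub>v xb t"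
        using signal_on_dim_vec[OF sx t] unfolding xa_def xb_def by (intro eq_vecI) auto
      then show "sysA ?S *\<^sub>v x t + sysB ?S *\<^sub>v u t =
        (sysA Sa *\<^sub>v xa t + sysB Sa *\<^sub>v v t) @\<^sub>v (sysA Sb *\<^sub>v xb t + sysB Sb *\<^sub>v u t)"
        "sysC ?S *\<^sub>v x t + sysD ?S *\<^sub>v u t = sysC Sa *\<^sub>v xa t + sysD Sa *\<^sub>v v t"
        using cascade_equations[OF Sa Sb _ _ _ v_def] sa sb u t unfolding signal_on_def by auto
    qed
    have der: "((\<lambda>s. vec_index (x s) i) has_real_derivative
        vec_index ((sysA Sa *\<^sub>v xa t + sysB Sa *\<^sub>v v t) @\<^sub>v
          (sysA Sb *\<^sub>v xb t + sysB Sb *\<^sub>v u t)) i) (at t within T)"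
      if "t \<in> T" "i < na + nb" for t i
      using x that unfolding trajectory_on_def dims by (simp add: eqs)
    have "trajectory_on T Sa v xa y"
      unfolding trajectory_on_def dims
    proof (intro conjI ballI allI impI v sa y)
      fix t i assume t: "t \<in> T" and i: "i < na"
      show "((\<lambda>s. vec_index (xa s) i) has_real_derivative
          vec_index (sysA Sa *\<^sub>v xa t + sysB Sa *\<^sub>v v t) i) (at t within T)"
        using der[OF t, of i] i b by (simp add: xa_def)
    next
      fix t assume "t \<in> T"
      then show "y t = sysC Sa *\<^sub>v xa t + sysD Sa *\<^sub>v v t"
        using x eqs(2) unfolding trajectory_on_def by simp
    qed
    moreover have "trajectory_on T Sb u xb v"
      unfolding trajectory_on_def dims
    proof (intro conjI ballI allI impI v sb u)
      fix t i assume t: "t \<in> T" and i: "i < nb"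
      show "((\<lambda>s. vec_index (xb s) i) has_real_derivative
          vec_index (sysA Sb *\<^sub>v xb t + sysB Sb *\<^sub>v u t) i) (at t within T)"
        using der[OF t, of "na + i"] i b by (simp add: xb_def)
    qed (simp add: v_def)
    ultimately show "\<exists>v. is_output_on T Sa v y \<and> is_output_on T Sb u v"
      unfolding is_output_on_def by blast
  next
    assume "\<exists>v. is_output_on T Sa v y \<and> is_output_on T Sb u v"
    then obtain v xa xb where ta: "trajectory_on T Sa v xa y" and tb: "trajectory_on T Sb u xb v"
      unfolding is_output_on_def by auto
    \<comment> \<open>Entry by entry again: off \<open>T\<close> the concatenation of \<open>xa\<close> and \<open>xb\<close> would place the
      entries of \<open>xb\<close> according to the unknown dimension of \<open>xa\<close>.\<close>
    define x where
      "x t = vec (na + nb) (\<lambda>i. if i < na then vec_index (xa t) i else vec_index (xb t) (i - na))" for t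
    have sa: "signal_on T na xa" and sb: "signal_on T nb xb"
      and u: "signal_on T m u" and y: "signal_on T m y"
      using ta tb unfolding trajectory_on_def dims by auto
    have app: "x t = xa t @\<^sub>v xb t" if "t \<in> T" for t
      using signal_on_dim_vec[OF sa that] signal_on_dim_vec[OF sb that] unfolding x_def
      by (intro eq_vecI) auto
    have eqs: "sysA ?S *\<^sub>v x t + sysB ?S *\<^sub>v u t =
        (sysA Sa *\<^sub>v xa t + sysB Sa *\<^sub>v v t) @\<^sub>v (sysA Sb *\<^sub>v xb t + sysB Sb *\<^sub>v u t)"
      "sysC ?S *\<^sub>v x t + sysD ?S *\<^sub>v u t = sysC Sa *\<^sub>v xa t + sysD Sa *\<^sub>v v t" if t: "t \<in> T" for t
    proof -
      have "v t = sysC Sb *\<^sub>v xb t + sysD Sb *\<^sub>v u t"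
        using tb t unfolding trajectory_on_def by blast
      then show "sysA ?S *\<^sub>v x t + sysB ?S *\<^sub>v u t =
        (sysA Sa *\<^sub>v xa t + sysB Sa *\<^sub>v v t) @\<^sub>v (sysA Sb *\<^sub>v xb t + sysB Sb *\<^sub>v u t)"
        "sysC ?S *\<^sub>v x t + sysD ?S *\<^sub>v u t = sysC Sa *\<^sub>v xa t + sysD Sa *\<^sub>v v t"
        using cascade_equations[OF Sa Sb, of "xa t" "xb t" "u t" "v t"] sa sb u t app[OF t]
        unfolding signal_on_def by auto
    qed
    have "trajectory_on T ?S u x y"
      unfolding trajectory_on_def dims
    proof (intro conjI ballI allI impI u y)
      show "signal_on T (na + nb) x"
        using signal_on_append_vec[OF sa sb] signal_on_cong[of T x "\<lambda>t. xa t @\<^sub>v xb t"] app by simp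
    next
      fix t i assume t: "t \<in> T" and i: "i < na + nb"
      show "((\<lambda>s. vec_index (x s) i) has_real_derivative
          vec_index (sysA ?S *\<^sub>v x t + sysB ?S *\<^sub>v u t) i) (at t within T)"
      proof (cases "i < na")
        case True
        then show ?thesis
          unfolding eqs(1)[OF t] using ta t i b unfolding trajectory_on_def dims by (simp add: x_def)
      next
        case False
        then have "i - na < nb" using i by simp
        with False show ?thesis
          unfolding eqs(1)[OF t] using tb t i b unfolding trajectory_on_def dims by (simp add: x_def)
      qed
    next
      fix t assume "t \<in> T"
      then show "y t = sysC ?S *\<^sub>v x t + sysD ?S *\<^sub>v u t"
        using ta eqs(2) unfolding trajectory_on_def by simp
    qed
    then show "is_output_on T ?S u y" unfolding is_output_on_def by blast
  qed
qed

section \<open>The feedback connection\<close>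

text \<open>
  On the left is the lower right feedthrough block of the cascade product of two chain transforms,
  with \<open>Ep\<close> and \<open>Eq\<close> the inverses of \<open>Dp21\<close> and \<open>Dq21\<close>. The factorisation shows that
  the well-posedness condition of the feedback loop makes this block invertible.
\<close>

lemma cascade_chain_D22:
  fixes Ep Eq Dp22 Dq11 :: "real mat"
  assumes "Ep \<in> carrier_mat h h" "Eq \<in> carrier_mat h h" "Dp22 \<in> carrier_mat h h" "Dq11 \<in> carrier_mat h h"
  shows "- (Ep * Dp22) * (Dq11 * Eq) + Ep * Eq = Ep * (1\<^sub>m h - Dp22 * Dq11) * Eq"
proof -
  have "Ep * (1\<^sub>m h - Dp22 * Dq11) * Eq = Ep * Eq - (Ep * Dp22) * (Dq11 * Eq)"
    using assms by (simp add: mult_minus_distrib_mat[where nr=h and n=h and nc=h]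
        minus_mult_distrib_mat[where nr=h and n=h and nc=h]
        assoc_mult_mat[where n\<^sub>1=h and n\<^sub>2=h and n\<^sub>3=h and n\<^sub>4=h])
  also have "\<dots> = - (Ep * Dp22) * (Dq11 * Eq) + Ep * Eq"
    using assms by (intro eq_matI) auto
  finally show ?thesis by simp
qed

text \<open>
  The system obtained here is \<open>\<Sigma>p \<star> \<Sigma>q\<close>. By the factorisation the lower right
  feedthrough block of the cascade product is a product of three invertible matrices, which places
  the cascade product in the range of the chain transform.
\<close>

lemma cascade_of_chains_is_chain:
  assumes p: "conformal_blocks np h Ap Bp1 Bp2 Cp1 Cp2 Dp11 Dp12 Dp21 Dp22" "invertible_mat Dp21"
    and q: "conformal_blocks nq h Aq Bq1 Bq2 Cq1 Cq2 Dq11 Dq12 Dq21 Dq22" "invertible_mat Dq21"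
    and \<Delta>: "invertible_mat (1\<^sub>m h - Dp22 * Dq11)"
  obtains \<Gamma>p \<Gamma>q A B1 B2 C1 C2 D11 D12 D21 D22
  where "chain (split_sys Ap Bp1 Bp2 Cp1 Cp2 Dp11 Dp12 Dp21 Dp22) = Some \<Gamma>p"
    and "realisation np (2 * h) \<Gamma>p"
    and "chain (split_sys Aq Bq1 Bq2 Cq1 Cq2 Dq11 Dq12 Dq21 Dq22) = Some \<Gamma>q"
    and "realisation nq (2 * h) \<Gamma>q"
    and "conformal_blocks (np + nq) h A B1 B2 C1 C2 D11 D12 D21 D22" "invertible_mat D21"
    and "chain (split_sys A B1 B2 C1 C2 D11 D12 D21 D22) = Some (cascade \<Gamma>p \<Gamma>q)"
proof -
  have D: "Dp21 \<in> carrier_mat h h" "Dp22 \<in> carrier_mat h h" "Dq11 \<in> carrier_mat h h"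
    "Dq21 \<in> carrier_mat h h"
    using p(1) q(1) unfolding conformal_blocks_def by blast+
  obtain Ep where Ep: "Ep \<in> carrier_mat h h" "Dp21 * Ep = 1\<^sub>m h" "Ep * Dp21 = 1\<^sub>m h"
    using p(2) invertible_mat_iff_inverse[OF D(1)] by blast
  obtain Eq where Eq: "Eq \<in> carrier_mat h h" "Dq21 * Eq = 1\<^sub>m h" "Eq * Dq21 = 1\<^sub>m h"
    using q(2) invertible_mat_iff_inverse[OF D(4)] by blast
  define \<Gamma>p where "\<Gamma>p = split_sys (Ap - Bp1 * Ep * Cp2) (Bp2 - Bp1 * Ep * Dp22) (Bp1 * Ep)
    (Cp1 - Dp11 * Ep * Cp2) (- (Ep * Cp2))
    (Dp12 - Dp11 * Ep * Dp22) (Dp11 * Ep) (- (Ep * Dp22)) Ep"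
  define \<Gamma>q where "\<Gamma>q = split_sys (Aq - Bq1 * Eq * Cq2) (Bq2 - Bq1 * Eq * Dq22) (Bq1 * Eq)
    (Cq1 - Dq11 * Eq * Cq2) (- (Eq * Cq2))
    (Dq12 - Dq11 * Eq * Dq22) (Dq11 * Eq) (- (Eq * Dq22)) Eq"
  note chain_p = chain_split_sys_Some[OF p(1) Ep, folded \<Gamma>p_def]
    and chain_q = chain_split_sys_Some[OF q(1) Eq, folded \<Gamma>q_def]
  note real_p = realisation_split_sys[OF conformal_blocks_chain[OF p(1) Ep(1)], folded \<Gamma>p_def]
    and real_q = realisation_split_sys[OF conformal_blocks_chain[OF q(1) Eq(1)], folded \<Gamma>q_def]
  note blocks_p = conformal_blocks_chain[OF p(1) Ep(1), unfolded conformal_blocks_def]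
    and blocks_q = conformal_blocks_chain[OF q(1) Eq(1), unfolded conformal_blocks_def]
  define D22 where "D22 = - (Ep * Dp22) * (Dq11 * Eq) + Ep * Eq"
  have inv: "invertible_mat D22"
  proof -
    have \<Delta>_carrier: "1\<^sub>m h - Dp22 * Dq11 \<in> carrier_mat h h"
      using D(2,3) by (intro minus_carrier_mat mult_carrier_mat)
    have "invertible_mat Ep" using invertible_mat_iff_inverse[OF Ep(1)] Ep(2,3) D(1) by blast
    moreover have "invertible_mat Eq" using invertible_mat_iff_inverse[OF Eq(1)] Eq(2,3) D(4) by blast
    ultimately have "invertible_mat (Ep * (1\<^sub>m h - Dp22 * Dq11) * Eq)"
      by (intro invertible_mat_mult[OF mult_carrier_mat[OF Ep(1) \<Delta>_carrier] Eq(1)]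
          invertible_mat_mult[OF Ep(1) \<Delta>_carrier] \<Delta>)
    then show ?thesis unfolding D22_def cascade_chain_D22[OF Ep(1) Eq(1) D(2,3)] .
  qed
  have feedthrough: "sysD (cascade \<Gamma>p \<Gamma>q) = four_block_mat
      ((Dp12 - Dp11 * Ep * Dp22) * (Dq12 - Dq11 * Eq * Dq22) + (Dp11 * Ep) * (- (Eq * Dq22)))
      ((Dp12 - Dp11 * Ep * Dp22) * (Dq11 * Eq) + (Dp11 * Ep) * Eq)
      (- (Ep * Dp22) * (Dq12 - Dq11 * Eq * Dq22) + Ep * (- (Eq * Dq22)))
      D22"
    unfolding D22_def cascade_def \<Gamma>p_def \<Gamma>q_def split_sys_def lin_sys.simps
    by (rule mult_four_block_mat; use blocks_p blocks_q in blast)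
  obtain A B1 B2 C1 C2 D11 D12 D21
    where K: "conformal_blocks (np + nq) h A B1 B2 C1 C2 D11 D12 D21 D22"
      "cascade \<Gamma>p \<Gamma>q = split_sys A B1 B2 C1 C2 D11 D12 D21 D22"
  proof (rule realisation_splitE[OF realisation_cascade[OF real_p real_q] feedthrough])
    show "D22 \<in> carrier_mat h h"
      unfolding D22_def
      by (rule add_carrier_mat, rule mult_carrier_mat; use blocks_p blocks_q in blast)
  qed (rule add_carrier_mat, rule mult_carrier_mat; use blocks_p blocks_q in blast)+
  show thesis
    using chain_surj[OF K(1) inv] that[OF chain_p real_p chain_q real_q] K(2) by metis
qed

text \<open>
  The intermediate signal of the series connection, split into halves, is at the same time the input
  \<open>(u2, y2)\<close> of the first factor and the output \<open>(y1', u1')\<close> of the second. On \<open>T\<close>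
  this is exactly the coupling of the feedback connection; what the signals do elsewhere has no
  influence on being an output.
\<close>

lemma is_output_on_cascade_coupling:
  assumes real_p: "realisation np (2 * h) \<Gamma>p" and real_q: "realisation nq (2 * h) \<Gamma>q"
  shows "is_output_on T (cascade \<Gamma>p \<Gamma>q) w z \<longleftrightarrow>
    (\<exists>u2 y2 u1' y1'.
       signal_on T h u2 \<and> signal_on T h y2 \<and> signal_on T h u1' \<and> signal_on T h y1' \<and>
       (\<forall>t\<in>T. u2 t = y1' t) \<and> (\<forall>t\<in>T. u1' t = y2 t) \<and>
       is_output_on T \<Gamma>p (\<lambda>t. u2 t @\<^sub>v y2 t) z \<and>
       is_output_on T \<Gamma>q w (\<lambda>t. y1' t @\<^sub>v u1' t))" (is "?L \<longleftrightarrow> ?R")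
proof
  assume ?L
  then obtain v where vp: "is_output_on T \<Gamma>p v z" and vq: "is_output_on T \<Gamma>q w v"
    using is_output_on_cascade[OF real_p real_q] by blast
  have v: "signal_on T (2 * h) v"
    using vp real_p unfolding is_output_on_def trajectory_on_def realisation_def by auto
  define a where "a t = vec h (\<lambda>i. vec_index (v t) (0 + i))" for t
  define b where "b t = vec h (\<lambda>i. vec_index (v t) (h + i))" for t
  have ab: "signal_on T h a" "signal_on T h b"
    unfolding a_def b_def by (intro signal_on_subvector[OF v]; simp)+
  have v_eq: "v t = a t @\<^sub>v b t" if "t \<in> T" for t
    using signal_on_dim_vec[OF v that] unfolding a_def b_def by (intro eq_vecI) auto
  have "is_output_on T \<Gamma>p (\<lambda>t. a t @\<^sub>v b t) z"
    using vp is_output_on_cong[where v="\<lambda>t. a t @\<^sub>v b t", OF v_eq refl] by blast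
  moreover have "is_output_on T \<Gamma>q w (\<lambda>t. a t @\<^sub>v b t)"
    using vq is_output_on_cong[where z="\<lambda>t. a t @\<^sub>v b t", OF refl v_eq] by blast
  ultimately show ?R using ab by blast
next
  assume ?R
  then obtain u2 y2 u1' y1' where eq: "\<And>t. t \<in> T \<Longrightarrow> u2 t = y1' t" "\<And>t. t \<in> T \<Longrightarrow> u1' t = y2 t"
    and io: "is_output_on T \<Gamma>p (\<lambda>t. u2 t @\<^sub>v y2 t) z"
      "is_output_on T \<Gamma>q w (\<lambda>t. y1' t @\<^sub>v u1' t)"
    by blast
  have "is_output_on T \<Gamma>q w (\<lambda>t. u2 t @\<^sub>v y2 t)"
    using io(2) is_output_on_cong[of T w w "\<lambda>t. y1' t @\<^sub>v u1' t" "\<lambda>t. u2 t @\<^sub>v y2 t", OF refl] eq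
    by simp
  with io(1) show ?L using is_output_on_cascade[OF real_p real_q] by blast
qed

theorem theorem15:
  fixes np nq h :: nat
    and Ap Bp1 Bp2 Cp1 Cp2 Dp11 Dp12 Dp21 Dp22 :: "real mat"
    and Aq Bq1 Bq2 Cq1 Cq2 Dq11 Dq12 Dq21 Dq22 :: "real mat"
    and \<Sigma>p \<Sigma>q :: lin_sys
  assumes "Ap \<in> carrier_mat np np"
    and "Bp1 \<in> carrier_mat np h" "Bp2 \<in> carrier_mat np h"
    and "Cp1 \<in> carrier_mat h np" "Cp2 \<in> carrier_mat h np"
    and "Dp11 \<in> carrier_mat h h" "Dp12 \<in> carrier_mat h h"
    and "Dp21 \<in> carrier_mat h h" "Dp22 \<in> carrier_mat h h"
    and "Aq \<in> carrier_mat nq nq"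
    and "Bq1 \<in> carrier_mat nq h" "Bq2 \<in> carrier_mat nq h"
    and "Cq1 \<in> carrier_mat h nq" "Cq2 \<in> carrier_mat h nq"
    and "Dq11 \<in> carrier_mat h h" "Dq12 \<in> carrier_mat h h"
    and "Dq21 \<in> carrier_mat h h" "Dq22 \<in> carrier_mat h h"
    and "\<Sigma>p = split_sys Ap Bp1 Bp2 Cp1 Cp2 Dp11 Dp12 Dp21 Dp22"
    and "\<Sigma>q = split_sys Aq Bq1 Bq2 Cq1 Cq2 Dq11 Dq12 Dq21 Dq22"
    and "invertible_mat Dp21"
    and "invertible_mat Dq21"
    and "invertible_mat (1\<^sub>m h - Dp22 * Dq11)"
  shows "\<exists>\<Gamma>p \<Gamma>q. chain \<Sigma>p = Some \<Gamma>p \<and> chain \<Sigma>q = Some \<Gamma>q \<and>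
    (\<exists>n \<Sigma>. realisation n (2 * h) \<Sigma> \<and>
       chain \<Sigma> = Some (cascade \<Gamma>p \<Gamma>q) \<and>
       (\<forall>T u1 u2' y1 y2'.
          is_interval T \<longrightarrow>
          signal_on T h u1 \<longrightarrow> signal_on T h u2' \<longrightarrow>
          signal_on T h y1 \<longrightarrow> signal_on T h y2' \<longrightarrow>
          (is_output_on T \<Sigma> (\<lambda>t. u1 t @\<^sub>v u2' t) (\<lambda>t. y1 t @\<^sub>v y2' t) \<longleftrightarrow>
           (\<exists>u2 y2 u1' y1'.
              signal_on T h u2 \<and> signal_on T h y2 \<and>
              signal_on T h u1' \<and> signal_on T h y1' \<and>
              (\<forall>t\<in>T. u2 t = y1' t) \<and> (\<forall>t\<in>T. u1' t = y2 t) \<and>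
              is_output_on T \<Sigma>p (\<lambda>t. u1 t @\<^sub>v u2 t) (\<lambda>t. y1 t @\<^sub>v y2 t) \<and>
              is_output_on T \<Sigma>q (\<lambda>t. u1' t @\<^sub>v u2' t) (\<lambda>t. y1' t @\<^sub>v y2' t)))))"
proof -
  have p: "conformal_blocks np h Ap Bp1 Bp2 Cp1 Cp2 Dp11 Dp12 Dp21 Dp22"
    and q: "conformal_blocks nq h Aq Bq1 Bq2 Cq1 Cq2 Dq11 Dq12 Dq21 Dq22"
    unfolding conformal_blocks_def by (intro conjI assms)+
  note inv = \<open>invertible_mat Dp21\<close> \<open>invertible_mat Dq21\<close>
    and \<Delta> = \<open>invertible_mat (1\<^sub>m h - Dp22 * Dq11)\<close>
  obtain \<Gamma>p \<Gamma>q A B1 B2 C1 C2 D11 D12 D21 D22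
    where chain_p: "chain \<Sigma>p = Some \<Gamma>p" and real_p: "realisation np (2 * h) \<Gamma>p"
      and chain_q: "chain \<Sigma>q = Some \<Gamma>q" and real_q: "realisation nq (2 * h) \<Gamma>q"
      and S: "conformal_blocks (np + nq) h A B1 B2 C1 C2 D11 D12 D21 D22" "invertible_mat D21"
        "chain (split_sys A B1 B2 C1 C2 D11 D12 D21 D22) = Some (cascade \<Gamma>p \<Gamma>q)"
    unfolding \<open>\<Sigma>p = _\<close> \<open>\<Sigma>q = _\<close> by (rule cascade_of_chains_is_chain[OF p inv(1) q inv(2) \<Delta>])
  let ?\<Sigma> = "split_sys A B1 B2 C1 C2 D11 D12 D21 D22"
  have out_p: "is_output_on T \<Sigma>p (\<lambda>t. u1 t @\<^sub>v u2 t) (\<lambda>t. y1 t @\<^sub>v y2 t) \<longleftrightarrow>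
      is_output_on T \<Gamma>p (\<lambda>t. u2 t @\<^sub>v y2 t) (\<lambda>t. y1 t @\<^sub>v u1 t)"
    if "signal_on T h u1" "signal_on T h u2" "signal_on T h y1" "signal_on T h y2" for T u1 u2 y1 y2
    using is_output_on_chain[OF p inv(1) _ that] chain_p unfolding \<open>\<Sigma>p = _\<close> .
  have out_q: "is_output_on T \<Sigma>q (\<lambda>t. u1 t @\<^sub>v u2 t) (\<lambda>t. y1 t @\<^sub>v y2 t) \<longleftrightarrow>
      is_output_on T \<Gamma>q (\<lambda>t. u2 t @\<^sub>v y2 t) (\<lambda>t. y1 t @\<^sub>v u1 t)"
    if "signal_on T h u1" "signal_on T h u2" "signal_on T h y1" "signal_on T h y2" for T u1 u2 y1 y2
    using is_output_on_chain[OF q inv(2) _ that] chain_q unfolding \<open>\<Sigma>q = _\<close> .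
  have "is_output_on T ?\<Sigma> (\<lambda>t. u1 t @\<^sub>v u2' t) (\<lambda>t. y1 t @\<^sub>v y2' t) \<longleftrightarrow>
     (\<exists>u2 y2 u1' y1'. signal_on T h u2 \<and> signal_on T h y2 \<and> signal_on T h u1' \<and> signal_on T h y1' \<and>
        (\<forall>t\<in>T. u2 t = y1' t) \<and> (\<forall>t\<in>T. u1' t = y2 t) \<and>
        is_output_on T \<Sigma>p (\<lambda>t. u1 t @\<^sub>v u2 t) (\<lambda>t. y1 t @\<^sub>v y2 t) \<and>
        is_output_on T \<Sigma>q (\<lambda>t. u1' t @\<^sub>v u2' t) (\<lambda>t. y1' t @\<^sub>v y2' t))"
    if ext: "signal_on T h u1" "signal_on T h u2'" "signal_on T h y1" "signal_on T h y2'"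
    for T u1 u2' y1 y2'
    unfolding is_output_on_chain[OF S ext] is_output_on_cascade_coupling[OF real_p real_q]
    using out_p ext out_q by (intro iff_exI conj_cong refl) auto
  then show ?thesis
    using chain_p chain_q realisation_split_sys[OF S(1)] S(3)
    by (intro exI[of _ \<Gamma>p] exI[of _ \<Gamma>q] exI[of _ "np + nq"] exI[of _ ?\<Sigma>] conjI allI impI)
qed

end
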